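(* Let $\mathcal D=\{d_1,\dots,d_K\}$ be the candidate items, $x^0$ the prompt, $T\ge 1$ the budget, and let $\sigma_0,\sigma_1,\dots,\sigma_T$ be rankings (length-$K$ sequences of items of $\mathcal D$), where $\sigma_0$ is an arbitrary initial ranking and, for $1\le t\le T$, $\sigma_t$ is obtained from $\sigma_{t-1}$ by $$\sigma_t[i]=\begin{cases}\sigma_{t-1}[i] & \text{if } i\le i_t^*,\\ \arg\max_{d} P_{\mathrm{llm}}(d\mid x^0,\sigma_{t-1}[:i_t^*]) & \text{if } i=i_t^*+1,\\ \tilde\sigma_t[i] & \text{if } i>i_t^*+1,\end{cases}\qquad 1\le i\le K,$$ where $\tilde\sigma_t$ is a ranking drawn at random from the agent's distribution, and where $$i_t^*=\max\bigl\{\,i\in\{0,\dots,K\}\;:\;\forall j\in\{1,\dots,i\},\ \sigma_{t-1}[j]=\arg\max_{d}P_{\mathrm{llm}}(d\mid x^0,\sigma_{t-1}[:j-1])\,\bigr\}.$$ Then, for every realization of the sampled rankings $\tilde\sigma_t$: if $i_T^*<K$, then $i_t^*<i_{t+1}^*$ for all $1\le t<T$.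
   Context: Positions in a ranking are indexed by $1,\dots,K$; $\sigma[j]$ is the item in position $j$ and $\sigma[:m]=(\sigma[1],\dots,\sigma[m])$ is the prefix of length $m$ ($\sigma[:0]$ is empty). $P_{\mathrm{llm}}(\cdot\mid x^0,w)$ is a fixed function assigning to each finite sequence $w$ of items a probability distribution (the language model's next-token distribution given prompt $x^0$ followed by $w$), and $\arg\max_d P_{\mathrm{llm}}(d\mid x^0,w)\in\mathcal D$ denotes its maximizer over items $d\in\mathcal D$, made single-valued by a fixed deterministic tie-breaking rule. Thus $i_t^*$ is the length of the longest prefix of $\sigma_{t-1}$ that agrees with greedy autoregressive decoding of the language model. The agent's distribution from which $\tilde\sigma_t$ is drawn is the Bradley–Terry distribution on rankings, $\prod_{d\succ d'}\mathrm{Sigmoid}\bigl(h_\theta(d\mid q,s_{<t})-h_\theta(d'\mid q,s_{<t})\bigr)$, the product being over pairs of items with $d$ ranked ahead of $d'$; here $h_\theta$ is a real-valued relevance score depending on the query $q$ and on the state $s_{<t}$ (the model's encodings of the earlier rankings). *)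

theory Defs
  imports
    "HOL-Probability.Probability_Mass_Function"
    "HOL-Combinatorics.Multiset_Permutations"
begin

section \<open>Greedy decoding\<close>

text \<open>
  A deterministic tie-breaking rule turns \<^const>\<open>is_arg_max\<close> into a function: it selects one
  maximizer over \<open>D\<close> for every score function.
\<close>

definition argmax_rule :: "'a set \<Rightarrow> (('a \<Rightarrow> real) \<Rightarrow> 'a) \<Rightarrow> bool" where
  "argmax_rule D argmax \<longleftrightarrow> (\<forall>f. is_arg_max f (\<lambda>d. d \<in> D) (argmax f))"

text \<open>
  \<open>P x w\<close> is the next-token distribution given the prompt \<open>x\<close> followed by \<open>w\<close>. Its support need
  not be contained in the set of items.
\<close>

definition next_item ::
    "(('a \<Rightarrow> real) \<Rightarrow> 'a) \<Rightarrow> ('x \<Rightarrow> 'a list \<Rightarrow> 'a pmf) \<Rightarrow> 'x \<Rightarrow> 'a list \<Rightarrow> 'a" where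
  "next_item argmax P x w = argmax (\<lambda>d. pmf (P x w) d)"

text \<open>Positions are numbered from 1, so that \<open>\<sigma>[j]\<close> is \<open>\<sigma> ! (j - 1)\<close>.\<close>

definition greedy_prefix_length :: "('a list \<Rightarrow> 'a) \<Rightarrow> nat \<Rightarrow> 'a list \<Rightarrow> nat" where
  "greedy_prefix_length g K \<sigma> =
     Max {i \<in> {0..K}. \<forall>j\<in>{1..i}. \<sigma> ! (j - 1) = g (take (j - 1) \<sigma>)}"

section \<open>The Bradley--Terry distribution on rankings\<close>

definition sigmoid :: "real \<Rightarrow> real" where
  "sigmoid x = 1 / (1 + exp (- x))"

definition bt_weight :: "('a \<Rightarrow> real) \<Rightarrow> 'a list \<Rightarrow> real" where
  "bt_weight h r = (\<Prod>(i, j)\<in>{(i, j). i < j \<and> j < length r}. sigmoid (h (r ! i) - h (r ! j)))"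

text \<open>
  The weights of the orderings of \<open>D\<close> do not in general sum to 1: for three items with equal
  scores the sum is \<open>6 / 8\<close>. They are therefore normalized.
\<close>

definition bradley_terry :: "'a set \<Rightarrow> ('a \<Rightarrow> real) \<Rightarrow> 'a list pmf" where
  "bradley_terry D h = embed_pmf (\<lambda>r.
     if r \<in> permutations_of_set D
     then bt_weight h r / (\<Sum>r'\<in>permutations_of_set D. bt_weight h r') else 0)"

lemma sigmoid_pos: "sigmoid x > 0"
  unfolding sigmoid_def by (simp add: add_pos_pos)

lemma bt_weight_pos: "bt_weight h r > 0"
  unfolding bt_weight_def by (rule prod_pos) (auto simp: sigmoid_pos)

lemma sum_bt_weight_pos:
  assumes "finite D"
  shows "(\<Sum>r\<in>permutations_of_set D. bt_weight h r) > 0"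
  using assms by (intro sum_pos) (auto simp: bt_weight_pos)

lemma pmf_bradley_terry:
  assumes "finite D"
  shows "pmf (bradley_terry D h) r =
    (if r \<in> permutations_of_set D
     then bt_weight h r / (\<Sum>r'\<in>permutations_of_set D. bt_weight h r') else 0)"
proof -
  let ?S = "permutations_of_set D"
  let ?Z = "\<Sum>r'\<in>?S. bt_weight h r'"
  let ?f = "\<lambda>r. if r \<in> ?S then bt_weight h r / ?Z else 0"
  have Z: "?Z > 0" by (rule sum_bt_weight_pos[OF assms])
  have nonneg: "?f r \<ge> 0" for r
    using Z bt_weight_pos[of h r] by auto
  have "(\<integral>\<^sup>+r. ennreal (?f r) \<partial>count_space UNIV) = (\<Sum>r\<in>?S. ennreal (?f r))"
    by (rule nn_integral_count_space') auto
  also have "\<dots> = ennreal (\<Sum>r\<in>?S. ?f r)"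
    by (rule sum_ennreal) (rule nonneg)
  also have "(\<Sum>r\<in>?S. ?f r) = (\<Sum>r\<in>?S. bt_weight h r) / ?Z"
    unfolding sum_divide_distrib by (rule sum.cong) auto
  also have "\<dots> = 1"
    using Z by simp
  finally show ?thesis
    unfolding bradley_terry_def by (subst pmf_embed_pmf) (use nonneg in auto)
qed

lemma set_pmf_bradley_terry:
  assumes "finite D"
  shows "set_pmf (bradley_terry D h) = permutations_of_set D"
  using sum_bt_weight_pos[OF assms, of h] bt_weight_pos[of h]
  by (auto simp: set_pmf_eq pmf_bradley_terry[OF assms] less_imp_neq[symmetric])

end

theory Submission
  imports Defs
begin

text \<open>
  A step keeps the greedy prefix and appends the greedy continuation to it, so the prefix length
  grows by at least one, unless it already equals \<open>K\<close>. The value \<open>K\<close> persists once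
  reached, hence \<open>istar T < K\<close> rules it out at all earlier times.
\<close>

lemma greedy_prefix_length_in:
  "greedy_prefix_length g K \<sigma> \<in> {i \<in> {0..K}. \<forall>j\<in>{1..i}. \<sigma> ! (j - 1) = g (take (j - 1) \<sigma>)}"
  unfolding greedy_prefix_length_def by (rule Max_in) (auto intro: exI[of _ 0])

lemma greedy_prefix_length_le: "greedy_prefix_length g K \<sigma> \<le> K"
  using greedy_prefix_length_in[of g K \<sigma>] by simp

lemma nth_greedy_prefix:
  assumes "i < greedy_prefix_length g K \<sigma>"
  shows "\<sigma> ! i = g (take i \<sigma>)"
  \<comment> \<open>List index \<open>i\<close> is the 1-based position \<open>Suc i\<close> of the
    definition.\<close>
  using greedy_prefix_length_in[of g K \<sigma>] assms by (auto dest: bspec[of _ _ "Suc i"])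

lemma greedy_prefix_length_ge:
  assumes "m \<le> K" and "\<And>i. i < m \<Longrightarrow> \<sigma> ! i = g (take i \<sigma>)"
  shows "m \<le> greedy_prefix_length g K \<sigma>"
  unfolding greedy_prefix_length_def using assms by (intro Max_ge) auto

text \<open>What \<open>g\<close> prescribes at an index depends only on the entries before it.
  Keeping the greedy prefix therefore keeps it greedy, and the appended entry is the one
  \<open>g\<close> asks for. The minimum covers a prefix that already fills the list, where
  \<open>new\<close> is vacuous.\<close>

lemma greedy_prefix_length_extend:
  assumes "length \<sigma> = K" and "length \<tau> = K"
    and same: "\<And>i. i < greedy_prefix_length g K \<sigma> \<Longrightarrow> \<tau> ! i = \<sigma> ! i"
    and new: "greedy_prefix_length g K \<sigma> < K \<Longrightarrow>
      \<tau> ! greedy_prefix_length g K \<sigma> = g (take (greedy_prefix_length g K \<sigma>) \<sigma>)"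
  shows "min K (Suc (greedy_prefix_length g K \<sigma>)) \<le> greedy_prefix_length g K \<tau>"
proof (rule greedy_prefix_length_ge)
  fix i assume i: "i < min K (Suc (greedy_prefix_length g K \<sigma>))"
  \<comment> \<open>Even when \<open>i\<close> is the index of the new entry, all indices below
    \<open>i\<close> lie in the kept prefix.\<close>
  have "take i \<tau> = take i \<sigma>"
    using i assms(1,2) by (intro nth_equalityI) (auto intro!: same)
  moreover have "\<tau> ! i = g (take i \<sigma>)"
  proof (cases "i < greedy_prefix_length g K \<sigma>")
    case True
    then show ?thesis using same nth_greedy_prefix by metis
  next
    case False
    with i have "i = greedy_prefix_length g K \<sigma>" by simp
    with i new show ?thesis by simp
  qed
  ultimately show "\<tau> ! i = g (take i \<tau>)" by simp
qed simp

theorem theorem1: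
  fixes D :: "'a set" and K T :: nat
    and P :: "'x \<Rightarrow> 'a list \<Rightarrow> 'a pmf" and x0 :: 'x
    and argmax :: "('a \<Rightarrow> real) \<Rightarrow> 'a"
    and h :: "'q \<Rightarrow> 's \<Rightarrow> 'a \<Rightarrow> real" and q :: 'q and enc :: "'a list list \<Rightarrow> 's"
    and \<sigma> \<sigma>' :: "nat \<Rightarrow> 'a list" and istar :: "nat \<Rightarrow> nat"
  assumes "finite D" and "card D = K" and "T \<ge> 1"
    and "argmax_rule D argmax"
    and ranking: "\<And>t. t \<le> T \<Longrightarrow> length (\<sigma> t) = K \<and> set (\<sigma> t) \<subseteq> D"
    and sampled: "\<And>t. t \<in> {1..T} \<Longrightarrow>
      \<sigma>' t \<in> set_pmf (bradley_terry D (h q (enc (map \<sigma> [0..<t]))))"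
    and istar: "\<And>t. t \<in> {1..T} \<Longrightarrow>
      istar t = greedy_prefix_length (next_item argmax P x0) K (\<sigma> (t - 1))"
    and step: "\<And>t i. t \<in> {1..T} \<Longrightarrow> i \<in> {1..K} \<Longrightarrow>
      \<sigma> t ! (i - 1) =
        (if i \<le> istar t then \<sigma> (t - 1) ! (i - 1)
         else if i = istar t + 1 then next_item argmax P x0 (take (istar t) (\<sigma> (t - 1)))
         else \<sigma>' t ! (i - 1))"
  shows "istar T < K \<longrightarrow> (\<forall>t. 1 \<le> t \<and> t < T \<longrightarrow> istar t < istar (t + 1))"
proof (intro impI allI)
  fix t assume final: "istar T < K" and t: "1 \<le> t \<and> t < T"
  let ?g = "next_item argmax P x0"
  have grow: "min K (Suc (istar s)) \<le> istar (Suc s)" if s: "1 \<le> s" "s < T" for s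
  proof -
    have prev: "istar s = greedy_prefix_length ?g K (\<sigma> (s - 1))"
      using istar s by simp
    have le: "istar s \<le> K"
      unfolding prev by (rule greedy_prefix_length_le)
    \<comment> \<open>The next value \<open>istar (Suc s)\<close> is measured on \<sigma>
      \<open>s\<close>, the outcome of step \<open>s\<close>, so the bound is proved for that
      list.\<close>
    have "min K (Suc (istar s)) \<le> greedy_prefix_length ?g K (\<sigma> s)"
      unfolding prev
    proof (rule greedy_prefix_length_extend; (fold prev)?)
      show "length (\<sigma> (s - 1)) = K" "length (\<sigma> s) = K"
        using ranking s by simp_all
      show "\<sigma> s ! i = \<sigma> (s - 1) ! i" if "i < istar s" for i
        \<comment> \<open>Here \<open>le\<close> places position \<open>Suc i\<close> within
          \<open>{1..K}\<close>, as \<open>step\<close> demands.\<close>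
        using step[of s "Suc i"] s le that by simp
      show "\<sigma> s ! istar s = ?g (take (istar s) (\<sigma> (s - 1)))" if "istar s < K"
        using step[of s "Suc (istar s)"] s that by simp
    qed
    then show ?thesis
      using istar[of "Suc s"] s by simp
  qed
  have "istar t < K"
  proof (rule ccontr)
    assume "\<not> istar t < K"
    \<comment> \<open>Once \<open>K \<le> istar s\<close>, the minimum in \<open>grow\<close> equals
      \<open>K\<close>, which carries the bound to \<open>Suc s\<close>.\<close>
    have "K \<le> istar s" if "t \<le> s" "s \<le> T" for s
      using that
    proof (induction s rule: dec_induct)
      case base
      with \<open>\<not> istar t < K\<close> show ?case by simp
    next
      case (step s)
      with grow[of s] t show ?case by simp
    qed
    from this[of T] t final show False by simp
  qed
  \<comment> \<open>Below \<open>K\<close> the minimum is \<open>Suc (istar t)\<close>, which makes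
    the growth strict.\<close>
  with grow[of t] t show "istar t < istar (t + 1)" by simp
qed

end
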